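(* Consider the problem $$\min_{\bm v,K}\ \widehat J_{\mathrm{VaR}}:=\sum_{k=0}^{N-1}\Big(\|v_k\|_2+\alpha_{m,\gamma}\sqrt{\lambda_{\max}(P_{u,k})}\Big)\quad\text{s.t.}\quad g_x(\mathbb{E}[x_k],\mathrm{Cov}(x_k))\le 0\ (k=1,\dots,N),\quad g_u(\mathbb{E}[u_k],\mathrm{Cov}(u_k))\le 0\ (k=0,\dots,N-1),$$ over all state-history-affine policies (all $\bm v=(v_0,\dots,v_{N-1})$ and all gains $\{K_{k,i}\}_{0\le i\le k\le N-1}$), where $g_x,g_u$ are covariance-monotonic. If $\pi^C$ is an optimal solution, then the Markovian policy $\pi^M$ constructed from it, $\pi^M_k(x_k)=v_k+H_k(x_k-\mu_k)$ with $H_k=P_{ux,k}P_{x,k}^\dagger$ (all moments taken under $\pi^C$), attains the same optimal objective value. Moreover, $\pi^M$ preserves the state and control means of $\pi^C$ and satisfies $$P_{x,k}^M\preceq P_{x,k}^C,\qquad P_{u,k}^M\preceq P_{u,k}^C$$ for all $k$, where $P^C_{x,k},P^C_{u,k}$ and $P^M_{x,k},P^M_{u,k}$ denote the covariances of $x_k,u_k$ under $\pi^C$ and under $\pi^M$, respectively.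
   Context: System: for $k=0,\dots,N-1$, $x_{k+1}=A_kx_k+B_ku_k+G_kw_k$ with $x_k\in\mathbb{R}^n$, $u_k\in\mathbb{R}^m$, $w_k\in\mathbb{R}^l$, where $w_0,\dots,w_{N-1}$ are i.i.d. $\mathcal N(0,I_l)$, and $x_0\sim\mathcal N(\mu_0,P_0)$, $P_0\succeq0$, is independent of $\{w_k\}$. State-history-affine policy $\pi^C$: $u_k=v_k+\sum_{i=0}^kK_{k,i}(x_i-\mathbb{E}[x_i])$, with $v_k\in\mathbb{R}^m$, $K_{k,i}\in\mathbb{R}^{m\times n}$. Under it, $\mu_k=\mathbb{E}[x_k]$, $v_k=\mathbb{E}[u_k]$, $P_{x,k}=\mathrm{Cov}(x_k)$, $P_{u,k}=\mathrm{Cov}(u_k)$, $P_{ux,k}=\mathbb{E}[(u_k-v_k)(x_k-\mu_k)^\top]$. For $\gamma\in(0,1)$, $\alpha_{m,\gamma}=\sqrt{\Phi^{-1}_{\chi^2_m}(1-\gamma)}$, where $\Phi^{-1}_{\chi^2_m}$ is the inverse cumulative distribution function of a chi-square random variable with $m$ degrees of freedom. $\lambda_{\max}$ is the largest eigenvalue, $X^\dagger$ is the Moore–Penrose pseudoinverse and $\preceq$ is the Loewner order. Covariance-monotonic: a function $g:\mathbb{R}^d\times\mathbb{S}_+^d\to\mathbb{R}$ ($\mathbb{S}^d_+$ = symmetric positive semidefinite $d\times d$ matrices) defining a constraint $g(\mu,P)\le0$ is covariance-monotonic if $P_1\preceq P_2$ implies $g(\mu,P_1)\le g(\mu,P_2)$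 for every $\mu$. Here $g_x$ is defined on $\mathbb{R}^n\times\mathbb{S}_+^n$ and $g_u$ on $\mathbb{R}^m\times\mathbb{S}_+^m$. *)

theory Defs
  imports "HOL-Probability.Probability"
begin

section \<open>Symmetric matrices\<close>

definition psd :: "real^'d^'d \<Rightarrow> bool" where
  "psd P \<longleftrightarrow> transpose P = P \<and> (\<forall>x. 0 \<le> x \<bullet> (P *v x))"

definition loewner_le :: "real^'d^'d \<Rightarrow> real^'d^'d \<Rightarrow> bool"  (infix "\<preceq>\<^sub>L" 50) where
  "P \<preceq>\<^sub>L Q \<longleftrightarrow> psd (Q - P)"

definition is_eigenvalue :: "real^'d^'d \<Rightarrow> real \<Rightarrow> bool" where
  "is_eigenvalue P c \<longleftrightarrow> (\<exists>x. x \<noteq> 0 \<and> P *v x = c *\<^sub>R x)"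

text \<open>Used for symmetric matrices only, where a greatest real eigenvalue exists.\<close>

definition lambda_max :: "real^'d^'d \<Rightarrow> real" where
  "lambda_max P = (GREATEST c. is_eigenvalue P c)"

text \<open>The four Penrose conditions.\<close>

definition is_pinv :: "real^'a^'b \<Rightarrow> real^'b^'a \<Rightarrow> bool" where
  "is_pinv A X \<longleftrightarrow>
     A ** X ** A = A \<and> X ** A ** X = X \<and>
     transpose (A ** X) = A ** X \<and> transpose (X ** A) = X ** A"

definition pinv :: "real^'a^'b \<Rightarrow> real^'b^'a" where
  "pinv A = (THE X. is_pinv A X)"

text \<open>The second argument of the constraint function ranges over positive semidefinite matrices;
  values elsewhere are irrelevant.\<close>

definition covariance_monotonic :: "(real^'d \<Rightarrow> real^'d^'d \<Rightarrow> real) \<Rightarrow> bool" where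
  "covariance_monotonic g \<longleftrightarrow>
     (\<forall>\<mu> P\<^sub>1 P\<^sub>2. psd P\<^sub>1 \<longrightarrow> psd P\<^sub>2 \<longrightarrow> P\<^sub>1 \<preceq>\<^sub>L P\<^sub>2 \<longrightarrow> g \<mu> P\<^sub>1 \<le> g \<mu> P\<^sub>2)"


section \<open>Random vectors\<close>

text \<open>\<open>E[(X - E X) (Y - E Y)\<^sup>T]\<close>, written entrywise.\<close>

definition cross_cov :: "'w measure \<Rightarrow> ('w \<Rightarrow> real^'a) \<Rightarrow> ('w \<Rightarrow> real^'b) \<Rightarrow> real^'b^'a" where
  "cross_cov M X Y =
     (\<chi> i j. integral\<^sup>L M (\<lambda>\<omega>. (X \<omega> - integral\<^sup>L M X) $ i * (Y \<omega> - integral\<^sup>L M Y) $ j))"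

definition cov :: "'w measure \<Rightarrow> ('w \<Rightarrow> real^'a) \<Rightarrow> real^'a^'a" where
  "cov M X = cross_cov M X X"

text \<open>Univariate normal law with mean \<open>m\<close> and variance \<open>s\<close>; the degenerate case is a point mass.\<close>

definition normal_law :: "real \<Rightarrow> real \<Rightarrow> real measure" where
  "normal_law m s =
     (if s = 0 then return borel m else density lborel (normal_density m (sqrt s)))"

text \<open>A random vector is \<open>N(\<mu>, P)\<close> iff each linear functional \<open>a\<close> of it is
  \<open>N(a\<^sup>T \<mu>, a\<^sup>T P a)\<close>; this covers singular \<open>P\<close>.\<close>

definition gaussian_vector ::
    "'w measure \<Rightarrow> ('w \<Rightarrow> real^'d) \<Rightarrow> real^'d \<Rightarrow> real^'d^'d \<Rightarrow> bool" where
  "gaussian_vector M X \<mu> P \<longleftrightarrow>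
     X \<in> borel_measurable M \<and>
     (\<forall>a. distr M borel (\<lambda>\<omega>. a \<bullet> X \<omega>) = normal_law (a \<bullet> \<mu>) (a \<bullet> (P *v a)))"

definition chi_square_distribution :: "nat \<Rightarrow> real measure" where
  "chi_square_distribution m =
     distr (Pi\<^sub>M {..<m} (\<lambda>_. std_normal_distribution)) borel (\<lambda>z. \<Sum>i<m. (z i)\<^sup>2)"

text \<open>The inverse of the cumulative distribution function, as the quantile function:
  for \<open>0 < p < 1\<close> it is the unique solution \<open>x\<close> of \<open>cdf D x = p\<close> when \<open>D\<close> is a chi-square law.\<close>

definition inverse_cdf :: "real measure \<Rightarrow> real \<Rightarrow> real" where
  "inverse_cdf D p = Inf {x. p \<le> cdf D x}"

definition alpha :: "nat \<Rightarrow> real \<Rightarrow> real" where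
  "alpha m \<gamma> = sqrt (inverse_cdf (chi_square_distribution m) (1 - \<gamma>))"


section \<open>Linear Gaussian systems\<close>

record ('w, 'n::finite, 'm::finite, 'l::finite) lin_sys =
  prob_sp :: "'w measure"
  horizon :: nat
  matA :: "nat \<Rightarrow> real^'n^'n"
  matB :: "nat \<Rightarrow> real^'m^'n"
  matG :: "nat \<Rightarrow> real^'l^'n"
  init_mean :: "real^'n"
  init_cov :: "real^'n^'n"
  init_state :: "'w \<Rightarrow> real^'n"
  noise :: "nat \<Rightarrow> 'w \<Rightarrow> real^'l"

text \<open>The library's \<open>indep_var\<close> needs both variables to have the same type, so independence of the
  initial state and the whole noise sequence is stated for the generated sigma-algebras.\<close>

definition linear_gaussian_system :: "('w, 'n::finite, 'm::finite, 'l::finite) lin_sys \<Rightarrow> bool" where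
  "linear_gaussian_system S \<longleftrightarrow>
     prob_space (prob_sp S) \<and>
     psd (init_cov S) \<and>
     gaussian_vector (prob_sp S) (init_state S) (init_mean S) (init_cov S) \<and>
     (\<forall>k<horizon S. gaussian_vector (prob_sp S) (noise S k) 0 (mat 1)) \<and>
     prob_space.indep_vars (prob_sp S) (\<lambda>_. borel) (noise S) {..<horizon S} \<and>
     prob_space.indep_set (prob_sp S)
       (sets (vimage_algebra (space (prob_sp S)) (init_state S) borel))
       (sets (vimage_algebra (space (prob_sp S)) (\<lambda>\<omega>. \<lambda>k\<in>{..<horizon S}. noise S k \<omega>)
         (Pi\<^sub>M {..<horizon S} (\<lambda>_. borel))))"

definition next_state ::
    "('w, 'n::finite, 'm::finite, 'l::finite) lin_sys \<Rightarrow> nat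
      \<Rightarrow> ('w \<Rightarrow> real^'n) \<Rightarrow> ('w \<Rightarrow> real^'m) \<Rightarrow> 'w \<Rightarrow> real^'n" where
  "next_state S k x u = (\<lambda>\<omega>. matA S k *v x \<omega> + matB S k *v u \<omega> + matG S k *v noise S k \<omega>)"


subsection \<open>State-history-affine policies\<close>

text \<open>\<open>affine_input M v K k x\<close> is the input at time \<open>k\<close>; it depends on the state process \<open>x\<close>
  only through \<open>x 0, \<dots>, x k\<close> and their means.\<close>

definition affine_input ::
    "'w measure \<Rightarrow> (nat \<Rightarrow> real^'m) \<Rightarrow> (nat \<Rightarrow> nat \<Rightarrow> real^'n^'m) \<Rightarrow> nat
      \<Rightarrow> (nat \<Rightarrow> 'w \<Rightarrow> real^'n) \<Rightarrow> 'w \<Rightarrow> real^'m" where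
  "affine_input M v K k x = (\<lambda>\<omega>. v k + (\<Sum>i\<le>k. K k i *v (x i \<omega> - integral\<^sup>L M (x i))))"

lemma affine_input_cong [fundef_cong]:
  assumes "M = M'" "v = v'" "K = K'" "k = k'" "\<And>i. i \<le> k' \<Longrightarrow> x i = x' i"
  shows "affine_input M v K k x = affine_input M' v' K' k' x'"
  using assms by (auto simp: affine_input_def intro!: ext sum.cong)

fun state_C ::
    "('w, 'n::finite, 'm::finite, 'l::finite) lin_sys \<Rightarrow> (nat \<Rightarrow> real^'m)
      \<Rightarrow> (nat \<Rightarrow> nat \<Rightarrow> real^'n^'m) \<Rightarrow> nat \<Rightarrow> 'w \<Rightarrow> real^'n" where
  "state_C S v K 0 = init_state S"
| "state_C S v K (Suc k) =
     next_state S k (state_C S v K k)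
       (affine_input (prob_sp S) v K k (\<lambda>i. state_C S v K i))"

definition control_C ::
    "('w, 'n::finite, 'm::finite, 'l::finite) lin_sys \<Rightarrow> (nat \<Rightarrow> real^'m)
      \<Rightarrow> (nat \<Rightarrow> nat \<Rightarrow> real^'n^'m) \<Rightarrow> nat \<Rightarrow> 'w \<Rightarrow> real^'m" where
  "control_C S v K k = affine_input (prob_sp S) v K k (state_C S v K)"


subsection \<open>Markovian policies\<close>

fun state_M ::
    "('w, 'n::finite, 'm::finite, 'l::finite) lin_sys \<Rightarrow> (nat \<Rightarrow> real^'n \<Rightarrow> real^'m)
      \<Rightarrow> nat \<Rightarrow> 'w \<Rightarrow> real^'n" where
  "state_M S \<pi> 0 = init_state S"
| "state_M S \<pi> (Suc k) = next_state S k (state_M S \<pi> k) (\<lambda>\<omega>. \<pi> k (state_M S \<pi> k \<omega>))"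

definition control_M ::
    "('w, 'n::finite, 'm::finite, 'l::finite) lin_sys \<Rightarrow> (nat \<Rightarrow> real^'n \<Rightarrow> real^'m)
      \<Rightarrow> nat \<Rightarrow> 'w \<Rightarrow> real^'m" where
  "control_M S \<pi> k = (\<lambda>\<omega>. \<pi> k (state_M S \<pi> k \<omega>))"

text \<open>The Markovian policy built from \<open>(v, K)\<close>; all moments are those of the closed loop under
  \<open>(v, K)\<close>.\<close>

definition markov_gain ::
    "('w, 'n::finite, 'm::finite, 'l::finite) lin_sys \<Rightarrow> (nat \<Rightarrow> real^'m)
      \<Rightarrow> (nat \<Rightarrow> nat \<Rightarrow> real^'n^'m) \<Rightarrow> nat \<Rightarrow> real^'n^'m" where
  "markov_gain S v K k =
     cross_cov (prob_sp S) (control_C S v K k) (state_C S v K k)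
       ** pinv (cov (prob_sp S) (state_C S v K k))"

definition markov_policy ::
    "('w, 'n::finite, 'm::finite, 'l::finite) lin_sys \<Rightarrow> (nat \<Rightarrow> real^'m)
      \<Rightarrow> (nat \<Rightarrow> nat \<Rightarrow> real^'n^'m) \<Rightarrow> nat \<Rightarrow> real^'n \<Rightarrow> real^'m" where
  "markov_policy S v K k x =
     v k + markov_gain S v K k *v (x - integral\<^sup>L (prob_sp S) (state_C S v K k))"


subsection \<open>The covariance-constrained problem\<close>

definition J_VaR ::
    "('w, 'n::finite, 'm::finite, 'l::finite) lin_sys \<Rightarrow> real \<Rightarrow> (nat \<Rightarrow> real^'m)
      \<Rightarrow> (nat \<Rightarrow> 'w \<Rightarrow> real^'m) \<Rightarrow> real" where
  "J_VaR S \<gamma> v u =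
     (\<Sum>k<horizon S. norm (v k) + alpha CARD('m) \<gamma> * sqrt (lambda_max (cov (prob_sp S) (u k))))"

definition satisfies_constraints ::
    "('w, 'n::finite, 'm::finite, 'l::finite) lin_sys
      \<Rightarrow> (real^'n \<Rightarrow> real^'n^'n \<Rightarrow> real) \<Rightarrow> (real^'m \<Rightarrow> real^'m^'m \<Rightarrow> real)
      \<Rightarrow> (nat \<Rightarrow> 'w \<Rightarrow> real^'n) \<Rightarrow> (nat \<Rightarrow> 'w \<Rightarrow> real^'m) \<Rightarrow> bool" where
  "satisfies_constraints S g\<^sub>x g\<^sub>u x u \<longleftrightarrow>
     (\<forall>k\<in>{1..horizon S}. g\<^sub>x (integral\<^sup>L (prob_sp S) (x k)) (cov (prob_sp S) (x k)) \<le> 0) \<and>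
     (\<forall>k<horizon S. g\<^sub>u (integral\<^sup>L (prob_sp S) (u k)) (cov (prob_sp S) (u k)) \<le> 0)"

text \<open>Only \<open>v k\<close> and \<open>K k i\<close> with \<open>i \<le> k < horizon S\<close> influence cost and constraints, so
  total functions can serve as decision variables.\<close>

definition feasible_C ::
    "('w, 'n::finite, 'm::finite, 'l::finite) lin_sys
      \<Rightarrow> (real^'n \<Rightarrow> real^'n^'n \<Rightarrow> real) \<Rightarrow> (real^'m \<Rightarrow> real^'m^'m \<Rightarrow> real)
      \<Rightarrow> (nat \<Rightarrow> real^'m) \<Rightarrow> (nat \<Rightarrow> nat \<Rightarrow> real^'n^'m) \<Rightarrow> bool" where
  "feasible_C S g\<^sub>x g\<^sub>u v K \<longleftrightarrow> satisfies_constraints S g\<^sub>x g\<^sub>u (state_C S v K) (control_C S v K)"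

definition optimal_C ::
    "('w, 'n::finite, 'm::finite, 'l::finite) lin_sys \<Rightarrow> real
      \<Rightarrow> (real^'n \<Rightarrow> real^'n^'n \<Rightarrow> real) \<Rightarrow> (real^'m \<Rightarrow> real^'m^'m \<Rightarrow> real)
      \<Rightarrow> (nat \<Rightarrow> real^'m) \<Rightarrow> (nat \<Rightarrow> nat \<Rightarrow> real^'n^'m) \<Rightarrow> bool" where
  "optimal_C S \<gamma> g\<^sub>x g\<^sub>u v K \<longleftrightarrow>
     feasible_C S g\<^sub>x g\<^sub>u v K \<and>
     (\<forall>v' K'. feasible_C S g\<^sub>x g\<^sub>u v' K' \<longrightarrow>
        J_VaR S \<gamma> v (control_C S v K) \<le> J_VaR S \<gamma> v' (control_C S v' K'))"

end

theory Submission
  imports Defs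
begin

text \<open>
  Regressing the input on the current state gives \<open>u\<^sub>k = H\<^sub>k x\<^sub>k + e\<^sub>k\<close> with \<open>e\<^sub>k\<close> uncorrelated with \<open>x\<^sub>k\<close>.
  Since the noise at time \<open>k\<close> is uncorrelated with everything up to time \<open>k\<close>, the state covariances of
  both closed loops obey the recursion \<open>P \<mapsto> (A + B H) P (A + B H)\<^sup>T + G Cov(w) G\<^sup>T\<close>, except that the
  history-dependent loop has the extra positive semidefinite term \<open>B Cov(e) B\<^sup>T\<close>; likewise \<open>Cov(u)\<close>
  has the extra term \<open>Cov(e)\<close>. By induction the Markovian covariances are smaller, so the
  Markovian policy is feasible and costs no more. The means do not depend on the gains, so the Markovian
  policy is itself a state-history-affine policy, and by optimality it costs no less.
\<close>

subsection \<open>Matrices\<close>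

lemma inner_matrix_vector_mult_transpose:
  fixes A :: "real^'a^'b"
  shows "x \<bullet> (A *v y) = (transpose A *v x) \<bullet> y"
  by (simp add: dot_lmul_matrix)

lemma transpose_add: "transpose (A + B) = transpose A + transpose (B :: real^'a^'b)"
  by (simp add: transpose_def vec_eq_iff)

lemma transpose_diff: "transpose (A - B) = transpose A - transpose (B :: real^'a^'b)"
  by (simp add: transpose_def vec_eq_iff)

lemma matrix_diff_ldistrib: "A ** (B - C) = A ** B - A ** (C :: real^'c^'b)" for A :: "real^'b^'a"
  by (simp add: vec_eq_iff matrix_matrix_mult_def right_diff_distrib sum_subtractf)

lemma matrix_diff_rdistrib: "(A - B) ** C = A ** C - B ** (C :: real^'c^'b)" for A :: "real^'b^'a"
  by (simp add: vec_eq_iff matrix_matrix_mult_def left_diff_distrib sum_subtractf)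

lemma matrix_add_rdistrib: "(A + B) ** C = A ** C + B ** (C :: real^'c^'b)" for A :: "real^'b^'a"
  by (simp add: vec_eq_iff matrix_matrix_mult_def distrib_right sum.distrib)

lemma matrix_vector_mult_minus: "(- A) *v x = - (A *v x)" for A :: "real^'a^'b"
  using matrix_vector_mult_diff_rdistrib[of 0 A x] by simp

lemma transpose_zero: "transpose (0 :: real^'a^'b) = 0"
  by (simp add: transpose_def vec_eq_iff)

text \<open>A matrix is determined by its bilinear form. Together with
  \<open>cross_cov_inner\<close> this reduces matrix identities between covariances to identities
  between scalar expectations.\<close>

lemma matrix_eqI_inner:
  fixes A B :: "real^'a^'b"
  assumes "\<And>a b. a \<bullet> (A *v b) = a \<bullet> (B *v b)"
  shows "A = B"
  using assms by (metis matrix_eq vector_eq_ldot)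

subsection \<open>The Loewner order\<close>

lemma psd_add: "psd P \<Longrightarrow> psd Q \<Longrightarrow> psd (P + Q)"
  by (simp add: psd_def transpose_add matrix_vector_mult_add_rdistrib inner_add_right)

lemma psd_congruence:
  fixes A :: "real^'a^'b"
  assumes "psd P"
  shows "psd (A ** P ** transpose A)"
proof -
  have "x \<bullet> ((A ** P ** transpose A) *v x) = (transpose A *v x) \<bullet> (P *v (transpose A *v x))" for x
    by (simp only: inner_matrix_vector_mult_transpose[of x A] flip: matrix_vector_mul_assoc)
  with assms show ?thesis
    by (simp add: psd_def matrix_transpose_mul matrix_mul_assoc del: transpose_matrix_vector)
qed

lemma loewner_le_add:
  assumes "P \<preceq>\<^sub>L P'" "Q \<preceq>\<^sub>L Q'"
  shows "P + Q \<preceq>\<^sub>L P' + Q'"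
  using psd_add[of "P' - P" "Q' - Q"] assms by (simp add: loewner_le_def algebra_simps)

lemma loewner_le_congruence:
  fixes A :: "real^'a^'b"
  assumes "P \<preceq>\<^sub>L Q"
  shows "A ** P ** transpose A \<preceq>\<^sub>L A ** Q ** transpose A"
  using psd_congruence[of "Q - P" A] assms
  by (simp add: loewner_le_def matrix_diff_ldistrib matrix_diff_rdistrib)

lemma loewner_le_refl: "P \<preceq>\<^sub>L P"
  by (simp add: loewner_le_def psd_def transpose_def vec_eq_iff)

text \<open>The quadratic form is minimal at \<open>x\<close>, so its gradient \<open>2 P x\<close> vanishes.\<close>

lemma psd_kernel:
  assumes "psd P" "x \<bullet> (P *v x) = 0"
  shows "P *v x = 0"
proof (rule ccontr)
  assume nz: "P *v x \<noteq> 0"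
  define y where "y = P *v x"
  have sym: "x \<bullet> (P *v y) = y \<bullet> y"
    using assms(1) by (simp only: inner_matrix_vector_mult_transpose psd_def y_def)
  have quad: "0 \<le> 2 * t * (y \<bullet> y) + t^2 * (y \<bullet> (P *v y))" for t
  proof -
    have "0 \<le> (x + t *\<^sub>R y) \<bullet> (P *v (x + t *\<^sub>R y))"
      using assms(1) by (simp add: psd_def)
    also have "\<dots> = 2 * t * (y \<bullet> y) + t^2 * (y \<bullet> (P *v y))"
      using sym assms(2)
      by (simp add: matrix_vector_right_distrib matrix_vector_mult_scaleR inner_add_left inner_add_right
          power2_eq_square y_def[symmetric] distrib_left)
    finally show ?thesis .
  qed
  \<comment> \<open>The step \<open>t = - (y \<bullet> y) / d\<close> makes the quadratic negative.
    Adding 1 keeps \<open>d\<close> positive even when the form vanishes at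
    \<open>y\<close>.\<close>
  define d where "d = y \<bullet> (P *v y) + 1"
  have d: "d > 0" using assms(1) by (simp add: d_def psd_def add_nonneg_pos)
  have a: "y \<bullet> y > 0" using nz by (simp add: y_def)
  have "0 \<le> 2 * (- (y \<bullet> y) / d) * (y \<bullet> y) + (- (y \<bullet> y) / d)^2 * (d - 1)"
    using quad[of "- (y \<bullet> y) / d"] by (simp add: d_def)
  also have "\<dots> = - ((y \<bullet> y)^2 * (d + 1)) / d^2"
    using d by (simp add: field_simps power2_eq_square)
  also have "\<dots> < 0" using a d by (simp add: divide_neg_pos zero_less_mult_iff)
  finally show False by simp
qed

subsection \<open>The largest eigenvalue\<close>

lemma eigenvalue_imp_rayleigh:
  assumes "is_eigenvalue P c"
  obtains x where "norm x = 1" "x \<bullet> (P *v x) = c"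
proof -
  from assms obtain x where x: "x \<noteq> 0" "P *v x = c *\<^sub>R x" by (auto simp: is_eigenvalue_def)
  have "P *v (x /\<^sub>R norm x) = c *\<^sub>R (x /\<^sub>R norm x)" using x by (simp add: matrix_vector_mult_scaleR)
  then show ?thesis
    using x by (intro that[of "x /\<^sub>R norm x"]) (simp_all add: dot_square_norm power2_eq_square field_simps)
qed

text \<open>Since \<open>lambda_max\<close> is a \<open>GREATEST\<close>, a greatest eigenvalue has
  to be exhibited. It is the maximum of the quadratic form on the unit sphere, attained by
  compactness; every eigenvalue is a value of the form at a unit vector and so lies below
  it.\<close>

lemma lambda_max_rayleigh:
  fixes P :: "real^'d^'d"
  assumes sym: "transpose P = P"
  shows "\<exists>x. norm x = 1 \<and> x \<bullet> (P *v x) = lambda_max P"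
    and "norm y = 1 \<Longrightarrow> y \<bullet> (P *v y) \<le> lambda_max P"
proof -
  have cont: "continuous_on (sphere 0 1) (\<lambda>x. x \<bullet> (P *v x))"
    by (intro continuous_intros matrix_vector_mult_linear_continuous_on)
  have "sphere (0 :: real^'d) 1 \<noteq> {}" by (simp add: sphere_empty)
  from continuous_attains_sup[OF compact_sphere this cont]
  obtain x where x: "norm x = 1" and le: "\<And>y. norm y = 1 \<Longrightarrow> y \<bullet> (P *v y) \<le> x \<bullet> (P *v x)"
    by auto
  define c where "c = x \<bullet> (P *v x)"
  have le': "y \<bullet> (P *v y) \<le> c * (y \<bullet> y)" for y
  proof (cases "y = 0")
    case False
    have "(y /\<^sub>R norm y) \<bullet> (P *v (y /\<^sub>R norm y)) \<le> c"
      using False by (simp only: c_def) (intro le, simp)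
    then show ?thesis
      using False by (simp add: matrix_vector_mult_scaleR dot_square_norm power2_eq_square field_simps)
  qed simp
  have mv: "(c *\<^sub>R mat 1 - P) *v y = c *\<^sub>R y - P *v y" for y
    by (simp add: matrix_vector_mult_diff_rdistrib flip: scaleR_matrix_vector_assoc)
  \<comment> \<open>The form of \<open>c I - P\<close> is nonnegative and vanishes at the maximiser
    \<open>x\<close>, so \<open>psd_kernel\<close> turns \<open>x\<close> into an eigenvector for
    \<open>c\<close>.\<close>
  have "psd (c *\<^sub>R mat 1 - P)"
    using le' sym by (simp add: psd_def transpose_diff transpose_scalar mv inner_diff_right)
  moreover have "x \<bullet> ((c *\<^sub>R mat 1 - P) *v x) = 0"
    using x by (simp only: mv inner_diff_right) (simp add: c_def dot_square_norm)
  ultimately have "P *v x = c *\<^sub>R x"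
    using psd_kernel[of "c *\<^sub>R mat 1 - P" x] by (simp add: mv)
  moreover have "x \<noteq> 0" using x by auto
  ultimately have "is_eigenvalue P c" by (auto simp: is_eigenvalue_def)
  then have "lambda_max P = c"
    unfolding lambda_max_def
    by (rule Greatest_equality) (metis eigenvalue_imp_rayleigh le c_def)
  with x le show "\<exists>x. norm x = 1 \<and> x \<bullet> (P *v x) = lambda_max P"
    and "norm y = 1 \<Longrightarrow> y \<bullet> (P *v y) \<le> lambda_max P"
    by (auto simp: c_def)
qed

text \<open>At a unit vector where the form of \<open>P\<close> is maximal, the form of
  \<open>Q\<close> is at least as large.\<close>

lemma lambda_max_mono:
  assumes "transpose P = P" "transpose Q = Q" "P \<preceq>\<^sub>L Q"
  shows "lambda_max P \<le> lambda_max Q"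
proof -
  obtain x where x: "norm x = 1" "x \<bullet> (P *v x) = lambda_max P"
    using lambda_max_rayleigh(1)[OF assms(1)] by auto
  have "x \<bullet> (P *v x) \<le> x \<bullet> (Q *v x)"
    using assms(3) by (simp add: loewner_le_def psd_def matrix_vector_mult_diff_rdistrib inner_diff_right)
  with x lambda_max_rayleigh(2)[OF assms(2) x(1)] show ?thesis by simp
qed

subsection \<open>The pseudoinverse of a symmetric matrix\<close>

text \<open>Both \<open>A X\<close> and \<open>A Y\<close> are symmetric, so transposing
  \<open>(A Y)(A X) = A X\<close> gives \<open>A X = A Y\<close>; in the same way
  \<open>X A = Y A\<close>. Then \<open>X = X A X = Y A Y = Y\<close>.\<close>

lemma is_pinv_unique:
  assumes X: "is_pinv A X" and Y: "is_pinv A Y"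
  shows "X = Y"
proof -
  have "A ** X = transpose (A ** Y ** A ** X)" using X Y by (simp add: is_pinv_def)
  also have "\<dots> = transpose ((A ** Y) ** (A ** X))" by (simp add: matrix_mul_assoc)
  also have "\<dots> = A ** X ** A ** Y"
    using X Y by (simp only: matrix_transpose_mul[of "A ** Y"]) (simp add: is_pinv_def matrix_mul_assoc)
  finally have AX: "A ** X = A ** Y" using X by (simp add: is_pinv_def)
  have "X ** A = transpose ((X ** A) ** (Y ** A))"
    using X Y by (simp add: is_pinv_def flip: matrix_mul_assoc)
  also have "\<dots> = (Y ** A) ** (X ** A)"
    using X Y by (simp only: matrix_transpose_mul[of "X ** A"]) (simp add: is_pinv_def)
  finally have XA: "X ** A = Y ** A" using X by (simp add: is_pinv_def flip: matrix_mul_assoc)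
  have "X = X ** (A ** X)" using X by (simp add: is_pinv_def matrix_mul_assoc)
  also have "\<dots> = Y ** A ** Y" by (simp add: AX matrix_mul_assoc XA)
  finally show ?thesis using Y by (simp add: is_pinv_def)
qed

text \<open>The witness is the sum of \<open>b b^T\<close> over an orthonormal basis of the kernel,
  that is, the orthogonal projection onto it. The vectors fixed by \<open>R\<close> form a subspace,
  so the last property only has to be checked on the basis.\<close>

lemma kernel_projection:
  fixes P :: "real^'d^'d"
  obtains R where "transpose R = R" "P ** R = 0" "\<And>x. P *v x = 0 \<Longrightarrow> R *v x = x"
proof -
  have "subspace {x. P *v x = 0}"
    by (auto simp: subspace_def matrix_vector_right_distrib matrix_vector_mult_scaleR)
  from orthonormal_basis_subspace[OF this] obtain B where
    B: "B \<subseteq> {x. P *v x = 0}" "pairwise orthogonal B" "\<And>x. x \<in> B \<Longrightarrow> norm x = 1"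
       "independent B" "span B = {x. P *v x = 0}"
    by metis
  have fin: "finite B" using B(4) by (rule independent_imp_finite)
  define R :: "real^'d^'d" where "R = (\<chi> i j. \<Sum>b\<in>B. b$i * b$j)"
  have Rx: "R *v x = (\<Sum>b\<in>B. (b \<bullet> x) *\<^sub>R b)" for x
    unfolding R_def vec_eq_iff matrix_vector_mult_def
    by (simp add: sum_distrib_right sum_distrib_left inner_vec_def sum.swap[of _ UNIV] mult_ac)
  show ?thesis
  proof
    show "transpose R = R" by (simp add: R_def transpose_def mult.commute)
    have "P *v (R *v x) = 0" for x
      using B(1) by (simp add: Rx linear_sum matrix_vector_mult_scaleR subset_iff)
    then show "P ** R = 0" by (simp add: matrix_eq matrix_vector_mul_assoc)
    fix x assume "P *v x = 0"
    then have "x \<in> span B" using B(5) by simp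
    then show "R *v x = x"
    proof (induction rule: span_induct)
      case base
      show ?case by (auto simp: subspace_def matrix_vector_right_distrib matrix_vector_mult_scaleR)
    next
      case (step b)
      have "R *v b = (\<Sum>c\<in>B. if c = b then b else 0)"
        unfolding Rx using B(2,3) step
        by (intro sum.cong) (auto simp: pairwise_def orthogonal_def dot_square_norm)
      with fin step show ?case by simp
    qed
  qed
qed

text \<open>With \<open>R\<close> the orthogonal projection onto the kernel of \<open>P\<close>, the matrix \<open>P + R\<close> is
  invertible and \<open>(P + R)\<^sup>-\<^sup>1 - R\<close> is the pseudoinverse.\<close>

lemma pinv_symmetric:
  fixes P :: "real^'d^'d"
  assumes sym: "transpose P = P"
  shows "is_pinv P (pinv P)"
proof -
  obtain R where R: "transpose R = R" "P ** R = 0" "\<And>x. P *v x = 0 \<Longrightarrow> R *v x = x"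
    using kernel_projection[of P] by metis
  have RP: "R ** P = 0"
  proof -
    have "transpose (P ** R) = R ** P" by (simp add: matrix_transpose_mul R(1) sym)
    then show ?thesis by (simp add: R(2) transpose_def vec_eq_iff)
  qed
  have RR: "R ** R = R"
      proof -
    have "P *v (R *v x) = 0" for x by (simp add: matrix_vector_mul_assoc R(2))
    then show ?thesis by (simp add: matrix_eq R(3) flip: matrix_vector_mul_assoc)
  qed
  \<comment> \<open>Applying \<open>R\<close> to the equation kills \<open>P x\<close> and leaves
    \<open>R x = 0\<close>. Then \<open>P x = 0\<close>, so \<open>x\<close> lies in the kernel and
    equals \<open>R x\<close>.\<close>
  have "x = 0" if "(P + R) *v x = 0" for x
  proof -
    have 1: "P *v x + R *v x = 0" using that by (simp add: matrix_vector_mult_add_rdistrib)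
    then have "R *v (P *v x + R *v x) = 0" by simp
    then have 2: "R *v x = 0" by (simp add: matrix_vector_right_distrib matrix_vector_mul_assoc RP RR)
    with 1 R(3)[of x] show ?thesis by simp
  qed
  then obtain Q where Q: "Q ** (P + R) = mat 1"
    by (meson matrix_left_invertible_ker)
  then have Q': "(P + R) ** Q = mat 1" by (simp add: matrix_left_right_inverse)
  have "Q ** R = Q ** ((P + R) ** R)" by (simp add: matrix_add_rdistrib R(2) RR)
  then have QR: "Q ** R = R" by (simp add: matrix_mul_assoc Q)
  have "R ** Q = (R ** (P + R)) ** Q" by (simp add: matrix_add_ldistrib RP RR)
  then have RQ: "R ** Q = R" by (simp add: Q' flip: matrix_mul_assoc)
  have PX: "P ** (Q - R) = mat 1 - R"
    using Q' by (simp add: matrix_diff_ldistrib R(2) matrix_add_rdistrib RQ algebra_simps)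
  have XP: "(Q - R) ** P = mat 1 - R"
    using Q by (simp add: matrix_diff_rdistrib RP matrix_add_ldistrib QR algebra_simps)
  have "is_pinv P (Q - R)"
    unfolding is_pinv_def PX XP
    by (simp add: matrix_diff_ldistrib matrix_diff_rdistrib RP RQ RR transpose_diff R(1))
  then show ?thesis
    unfolding pinv_def by (rule theI) (blast intro: is_pinv_unique \<open>is_pinv P (Q - R)\<close>)
qed

subsection \<open>Square-integrable random vectors\<close>

text \<open>The class in which all means and covariances below exist; it is closed under linear
  maps, sums and, on a probability space, constants.\<close>

definition square_integrable :: "'w measure \<Rightarrow> ('w \<Rightarrow> real^'a) \<Rightarrow> bool" where
  "square_integrable M X \<longleftrightarrow> X \<in> borel_measurable M \<and> integrable M (\<lambda>\<omega>. (norm (X \<omega>))\<^sup>2)"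

lemma integrable_dominated:
  fixes f :: "'w \<Rightarrow> 'b::{banach, second_countable_topology}"
  assumes "integrable M g" "f \<in> borel_measurable M" "\<And>x. norm (f x) \<le> g x"
  shows "integrable M f"
  by (rule Bochner_Integration.integrable_bound[OF assms(1,2)])
     (auto intro!: AE_I2 intro: assms(3) order.trans[OF _ abs_ge_self])

lemma square_integrable_diff:
  fixes X Y :: "'w \<Rightarrow> real^'a"
  assumes "square_integrable M X" "square_integrable M Y"
  shows "square_integrable M (\<lambda>\<omega>. X \<omega> - Y \<omega>)"
proof -
  note [measurable] = assms[unfolded square_integrable_def, THEN conjunct1]
  have "(norm (x - y))\<^sup>2 \<le> 2 * (norm x)\<^sup>2 + 2 * (norm y)\<^sup>2" for x y :: "real^'a"
  proof -
    have "(norm (x - y))\<^sup>2 \<le> (norm x + norm y)\<^sup>2" by (intro power_mono norm_triangle_ineq4 norm_ge_zero)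
    also have "\<dots> \<le> 2 * (norm x)\<^sup>2 + 2 * (norm y)\<^sup>2"
      using zero_le_power2[of "norm x - norm y"] by (simp add: power2_eq_square algebra_simps)
    finally show ?thesis .
  qed
  then have "integrable M (\<lambda>\<omega>. (norm (X \<omega> - Y \<omega>))\<^sup>2)"
    using assms
    by - (rule integrable_dominated[of M "\<lambda>\<omega>. 2 * (norm (X \<omega>))\<^sup>2 + 2 * (norm (Y \<omega>))\<^sup>2"],
        auto simp: square_integrable_def)
  then show ?thesis by (simp add: square_integrable_def)
qed

lemma square_integrable_zero: "square_integrable M (\<lambda>_. 0)"
  by (simp add: square_integrable_def)

lemma square_integrable_add:
  assumes "square_integrable M X" "square_integrable M Y"
  shows "square_integrable M (\<lambda>\<omega>. X \<omega> + Y \<omega>)"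
  using square_integrable_diff[OF assms(1) square_integrable_diff[OF square_integrable_zero assms(2)]]
  by simp

lemma measurable_matrix_vector_mult [measurable]:
  fixes A :: "real^'a^'b"
  shows "X \<in> borel_measurable M \<Longrightarrow> (\<lambda>\<omega>. A *v X \<omega>) \<in> borel_measurable M"
  by (rule borel_measurable_continuous_on) (rule matrix_vector_mult_linear_continuous_on)

lemma square_integrable_matrix:
  fixes A :: "real^'a^'b"
  assumes "square_integrable M X"
  shows "square_integrable M (\<lambda>\<omega>. A *v X \<omega>)"
proof -
  note [measurable] = assms[unfolded square_integrable_def, THEN conjunct1]
  define c where "c = onorm ((*v) A)"
  have "(norm (A *v x))\<^sup>2 \<le> c\<^sup>2 * (norm x)\<^sup>2" for x
    unfolding power_mult_distrib[symmetric] c_def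
    by (intro power_mono onorm matrix_vector_mul_bounded_linear norm_ge_zero)
  then have "integrable M (\<lambda>\<omega>. (norm (A *v X \<omega>))\<^sup>2)"
    using assms
    by - (rule integrable_dominated[of M "\<lambda>\<omega>. c\<^sup>2 * (norm (X \<omega>))\<^sup>2"],
        auto simp: square_integrable_def)
  then show ?thesis by (simp add: square_integrable_def)
qed

lemma (in prob_space) square_integrable_const: "square_integrable M (\<lambda>_. c)"
  by (simp add: square_integrable_def)

text \<open>Cauchy-Schwarz and the bound of a product by a sum of squares give an integrable
  majorant; hence the integrals defining covariances exist.\<close>

lemma square_integrable_mult:
  assumes "square_integrable M X" "square_integrable M Y"
  shows "integrable M (\<lambda>\<omega>. (a \<bullet> X \<omega>) * (b \<bullet> Y \<omega>))"
proof -
  note [measurable] = assms[unfolded square_integrable_def, THEN conjunct1]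
  have "\<bar>(a \<bullet> x) * (b \<bullet> y)\<bar> \<le> (norm a * norm b) * ((norm x)\<^sup>2 + (norm y)\<^sup>2)" for x y
  proof -
    have "\<bar>(a \<bullet> x) * (b \<bullet> y)\<bar> \<le> (norm a * norm x) * (norm b * norm y)"
      unfolding abs_mult by (intro mult_mono Cauchy_Schwarz_ineq2) auto
    also have "\<dots> = (norm a * norm b) * (norm x * norm y)" by simp
    also have "norm x * norm y \<le> (norm x)\<^sup>2 + (norm y)\<^sup>2"
      using sum_squares_bound[of "norm x" "norm y"] mult_nonneg_nonneg[OF norm_ge_zero norm_ge_zero, of x y]
      by linarith
    finally show ?thesis by (simp add: mult_left_mono)
  qed
  then show ?thesis
    using assms
    by - (rule integrable_dominated[of M "\<lambda>\<omega>. (norm a * norm b) * ((norm (X \<omega>))\<^sup>2 + (norm (Y \<omega>))\<^sup>2)"],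
        simp_all add: square_integrable_def)
qed

lemma (in prob_space) square_integrable_imp_integrable:
  fixes X :: "'a \<Rightarrow> real^'n"
  assumes "square_integrable M X"
  shows "integrable M X"
proof -
  have "norm x \<le> 1 + (norm x)\<^sup>2" for x :: "real^'n"
    using sum_squares_bound[of 1 "norm x"] norm_ge_zero[of x] unfolding mult_1 one_power2 by linarith
  then show ?thesis
    using assms
    by - (rule integrable_dominated[of M "\<lambda>\<omega>. 1 + (norm (X \<omega>))\<^sup>2" X],
        auto simp: square_integrable_def)
qed

lemma (in prob_space) expectation_matrix:
  fixes A :: "real^'n^'m"
  assumes "square_integrable M X"
  shows "integral\<^sup>L M (\<lambda>\<omega>. A *v X \<omega>) = A *v integral\<^sup>L M X"
  by (rule integral_bounded_linear[OF matrix_vector_mul_bounded_linear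
        square_integrable_imp_integrable[OF assms]])

subsection \<open>Cross-covariances\<close>

context prob_space
begin

lemma square_integrable_centered:
  "square_integrable M X \<Longrightarrow> square_integrable M (\<lambda>\<omega>. X \<omega> - integral\<^sup>L M X)"
  by (intro square_integrable_diff square_integrable_const)

text \<open>Coordinate-free form of the entrywise definition. The algebra of covariances is derived
  from it and not from the entries.\<close>

lemma cross_cov_inner:
  assumes "square_integrable M X" "square_integrable M Y"
  shows "a \<bullet> (cross_cov M X Y *v b) =
    integral\<^sup>L M (\<lambda>\<omega>. (a \<bullet> (X \<omega> - integral\<^sup>L M X)) * (b \<bullet> (Y \<omega> - integral\<^sup>L M Y)))"
proof -
  define X' Y' where X': "X' = (\<lambda>\<omega>. X \<omega> - integral\<^sup>L M X)" and Y': "Y' = (\<lambda>\<omega>. Y \<omega> - integral\<^sup>L M Y)"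
  have int: "integrable M (\<lambda>\<omega>. X' \<omega> $ i * Y' \<omega> $ j)" for i j
    using square_integrable_mult[of M X' Y' "axis i 1" "axis j 1"] assms
    by (simp add: X' Y' square_integrable_centered inner_axis')
  have "integral\<^sup>L M (\<lambda>\<omega>. (a \<bullet> X' \<omega>) * (b \<bullet> Y' \<omega>))
      = integral\<^sup>L M (\<lambda>\<omega>. \<Sum>i\<in>UNIV. \<Sum>j\<in>UNIV. a $ i * b $ j * (X' \<omega> $ i * Y' \<omega> $ j))"
    by (simp add: inner_vec_def sum_product mult_ac)
  also have "\<dots> = (\<Sum>i\<in>UNIV. \<Sum>j\<in>UNIV. a $ i * b $ j * integral\<^sup>L M (\<lambda>\<omega>. X' \<omega> $ i * Y' \<omega> $ j))"
    using int by simp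
  also have "\<dots> = a \<bullet> (cross_cov M X Y *v b)"
    by (simp add: cross_cov_def inner_vec_def matrix_vector_mult_def X' Y' sum_distrib_left mult_ac)
  finally show ?thesis by (simp add: X' Y')
qed

lemma transpose_cross_cov: "transpose (cross_cov M X Y) = cross_cov M Y X"
  by (simp add: cross_cov_def transpose_def mult.commute)

lemma cross_cov_add_left:
  assumes "square_integrable M X" "square_integrable M X'" "square_integrable M Y"
  shows "cross_cov M (\<lambda>\<omega>. X \<omega> + X' \<omega>) Y = cross_cov M X Y + cross_cov M X' Y"
proof (rule matrix_eqI_inner)
  fix a b
  let ?c = "\<lambda>X \<omega>. X \<omega> - integral\<^sup>L M X"
  have "integral\<^sup>L M (\<lambda>\<omega>. (a \<bullet> ?c (\<lambda>\<omega>. X \<omega> + X' \<omega>) \<omega>) * (b \<bullet> ?c Y \<omega>))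
     = integral\<^sup>L M (\<lambda>\<omega>. (a \<bullet> ?c X \<omega>) * (b \<bullet> ?c Y \<omega>) + (a \<bullet> ?c X' \<omega>) * (b \<bullet> ?c Y \<omega>))"
    using assms[THEN square_integrable_imp_integrable]
    by (intro Bochner_Integration.integral_cong) (simp_all add: algebra_simps)
  also have "\<dots> = integral\<^sup>L M (\<lambda>\<omega>. (a \<bullet> ?c X \<omega>) * (b \<bullet> ?c Y \<omega>)) + integral\<^sup>L M (\<lambda>\<omega>. (a \<bullet> ?c X' \<omega>) * (b \<bullet> ?c Y \<omega>))"
    using assms
    by (intro Bochner_Integration.integral_add square_integrable_mult square_integrable_centered)
  finally show "a \<bullet> (cross_cov M (\<lambda>\<omega>. X \<omega> + X' \<omega>) Y *v b) = a \<bullet> ((cross_cov M X Y + cross_cov M X' Y) *v b)"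
    using assms
    by (simp add: cross_cov_inner square_integrable_add matrix_vector_mult_add_rdistrib inner_add_right)
qed

lemma cross_cov_matrix_left:
  fixes A :: "real^'n^'m"
  assumes "square_integrable M X" "square_integrable M Y"
  shows "cross_cov M (\<lambda>\<omega>. A *v X \<omega>) Y = A ** cross_cov M X Y"
proof (rule matrix_eqI_inner)
  fix a b
  have "a \<bullet> (cross_cov M (\<lambda>\<omega>. A *v X \<omega>) Y *v b) = (transpose A *v a) \<bullet> (cross_cov M X Y *v b)"
    by (simp only: cross_cov_inner square_integrable_matrix assms expectation_matrix
        inner_matrix_vector_mult_transpose[of _ A] flip: matrix_vector_mult_diff_distrib)
  then show "a \<bullet> (cross_cov M (\<lambda>\<omega>. A *v X \<omega>) Y *v b) = a \<bullet> ((A ** cross_cov M X Y) *v b)"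
    by (simp only: inner_matrix_vector_mult_transpose[of a A] flip: matrix_vector_mul_assoc)
qed

lemma cross_cov_const_left: "cross_cov M (\<lambda>_. c) Y = 0"
  by (simp add: cross_cov_def vec_eq_iff prob_space)

lemma cross_cov_add_right:
  assumes "square_integrable M X" "square_integrable M Y" "square_integrable M Y'"
  shows "cross_cov M X (\<lambda>\<omega>. Y \<omega> + Y' \<omega>) = cross_cov M X Y + cross_cov M X Y'"
  using arg_cong[OF cross_cov_add_left[OF assms(2,3,1)], of transpose]
  by (simp add: transpose_add transpose_cross_cov)

lemma cross_cov_matrix_right:
  fixes A :: "real^'n^'m"
  assumes "square_integrable M X" "square_integrable M Y"
  shows "cross_cov M X (\<lambda>\<omega>. A *v Y \<omega>) = cross_cov M X Y ** transpose A"
  using arg_cong[OF cross_cov_matrix_left[OF assms(2,1), of A], of transpose]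
  by (simp add: matrix_transpose_mul transpose_cross_cov)

lemma cross_cov_const_right: "cross_cov M Y (\<lambda>_. c) = 0"
  by (simp add: cross_cov_def vec_eq_iff prob_space)

lemma transpose_cov: "transpose (cov M X) = cov M X"
  by (simp add: cov_def transpose_cross_cov)

lemma psd_cov: "square_integrable M X \<Longrightarrow> psd (cov M X)"
  unfolding psd_def transpose_cov by (simp add: cov_def cross_cov_inner)

lemma cov_const_loewner_le: "square_integrable M X \<Longrightarrow> cov M (\<lambda>_. c) \<preceq>\<^sub>L cov M X"
  using psd_cov[of X] by (simp add: loewner_le_def cov_def cross_cov_const_left)

lemma cov_matrix:
  fixes A :: "real^'n^'m"
  assumes "square_integrable M X"
  shows "cov M (\<lambda>\<omega>. A *v X \<omega>) = A ** cov M X ** transpose A"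
  using assms
  by (simp add: cov_def cross_cov_matrix_left cross_cov_matrix_right square_integrable_matrix matrix_mul_assoc)

lemma cov_add_uncorrelated:
  assumes "square_integrable M X" "square_integrable M Y" "cross_cov M X Y = 0"
  shows "cov M (\<lambda>\<omega>. X \<omega> + Y \<omega>) = cov M X + cov M Y"
proof -
  have "cross_cov M Y X = 0"
    using arg_cong[OF assms(3), of transpose] by (simp add: transpose_cross_cov transpose_zero)
  with assms show ?thesis
    by (simp add: cov_def cross_cov_add_left cross_cov_add_right square_integrable_add)
qed

text \<open>A linear functional of \<open>Z\<close> with variance zero equals its mean almost
  everywhere, so its product with anything centred integrates to zero.\<close>

lemma cross_cov_eq_0_if_cov_eq_0:
  assumes "square_integrable M X" "square_integrable M Z" "cov M Z = 0"
  shows "cross_cov M X Z = 0"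
proof (rule matrix_eqI_inner)
  fix a b
  let ?Z = "\<lambda>\<omega>. b \<bullet> (Z \<omega> - integral\<^sup>L M Z)"
  have "integral\<^sup>L M (\<lambda>\<omega>. ?Z \<omega> * ?Z \<omega>) = 0"
    using cross_cov_inner[OF assms(2,2), of b b] assms(3) by (simp add: cov_def)
  moreover have "integrable M (\<lambda>\<omega>. ?Z \<omega> * ?Z \<omega>)"
    using assms(2) by (intro square_integrable_mult square_integrable_centered)
  ultimately have "AE \<omega> in M. ?Z \<omega> * ?Z \<omega> = 0"
    by (subst (asm) integral_nonneg_eq_0_iff_AE) auto
  then have "integral\<^sup>L M (\<lambda>\<omega>. (a \<bullet> (X \<omega> - integral\<^sup>L M X)) * ?Z \<omega>) = 0"
    by (intro integral_eq_zero_AE) auto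
  then show "a \<bullet> (cross_cov M X Z *v b) = a \<bullet> (0 *v b)"
    using assms by (simp add: cross_cov_inner)
qed

text \<open>\<open>(1 - P\<^sup>\<dagger> P) X\<close> has covariance zero, so \<open>U\<close> cannot be correlated with it.\<close>

lemma cross_cov_pinv:
  assumes U: "square_integrable M U" and X: "square_integrable M X"
  shows "cross_cov M U X ** pinv (cov M X) ** cov M X = cross_cov M U X"
proof -
  define P D where P: "P = cov M X" and D: "D = mat 1 - pinv P ** P"
  have pinv: "is_pinv P (pinv P)" by (simp add: P pinv_symmetric transpose_cov)
  then have tD: "transpose D = D" by (simp add: is_pinv_def D transpose_diff)
  have PD: "P ** D = 0"
    using pinv by (simp add: is_pinv_def D matrix_diff_ldistrib matrix_mul_assoc)
  \<comment> \<open>The covariance is \<open>D P D^T\<close>, which vanishes because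
    \<open>P D = 0\<close>.\<close>
  have "cov M (\<lambda>\<omega>. D *v X \<omega>) = 0"
    by (simp add: cov_matrix[OF X] P[symmetric] tD PD flip: matrix_mul_assoc)
  then have "cross_cov M U (\<lambda>\<omega>. D *v X \<omega>) = 0"
    by (intro cross_cov_eq_0_if_cov_eq_0 U square_integrable_matrix X)
  then have "cross_cov M U X ** D = 0"
    by (simp add: cross_cov_matrix_right[OF U X] tD)
  then show ?thesis by (simp add: D P matrix_diff_ldistrib matrix_mul_assoc)
qed

text \<open>The residual is \<open>U - H X\<close>. It is uncorrelated with \<open>X\<close> because
  \<open>H\<close> solves the normal equations \<open>H Cov(X) = Cov(U, X)\<close>, also for
  singular \<open>Cov(X)\<close>, by \<open>cross_cov_pinv\<close>. The intercept stays in
  \<open>E\<close>, since covariances do not see it.\<close>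

lemma linear_regression:
  fixes U :: "'a \<Rightarrow> real^'m" and X :: "'a \<Rightarrow> real^'n"
  defines "H \<equiv> cross_cov M U X ** pinv (cov M X)"
  assumes U: "square_integrable M U" and X: "square_integrable M X"
  obtains E where "square_integrable M E" "U = (\<lambda>\<omega>. H *v X \<omega> + E \<omega>)" "cross_cov M X E = 0"
proof
  let ?E = "\<lambda>\<omega>. U \<omega> + (- H) *v X \<omega>"
  have mH: "square_integrable M (\<lambda>\<omega>. (- H) *v X \<omega>)" by (intro square_integrable_matrix X)
  show "square_integrable M ?E" by (intro square_integrable_add U mH)
  show "U = (\<lambda>\<omega>. H *v X \<omega> + ?E \<omega>)"
    by (simp add: fun_eq_iff matrix_vector_mult_minus)
  have "cross_cov M ?E X = cross_cov M U X + (- H) ** cov M X"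
    by (simp only: cross_cov_add_left[OF U mH X] cross_cov_matrix_left[OF X X] cov_def)
  also have "\<dots> = cross_cov M U X - H ** cov M X"
    using matrix_diff_rdistrib[of 0 H "cov M X"] by simp
  also have "\<dots> = 0" by (simp add: H_def cross_cov_pinv[OF U X])
  finally have "transpose (cross_cov M ?E X) = 0" by (simp add: transpose_zero)
  then show "cross_cov M X ?E = 0" by (simp only: transpose_cross_cov)
qed

subsection \<open>Independence\<close>

text \<open>Passes from independent sigma-algebras to independent variables. \<open>X\<close> and
  \<open>Y\<close> may have different types; only their images under \<open>f\<close> and
  \<open>g\<close> must share one. The sigma-algebras of the images are contained in those of
  \<open>X\<close> and \<open>Y\<close>.\<close>

lemma indep_var_vimage_algebra:
  assumes "indep_set (sets (vimage_algebra (space M) X N)) (sets (vimage_algebra (space M) Y L))"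
    and "X \<in> measurable M N" "Y \<in> measurable M L"
    and f: "f \<in> measurable N N'" and g: "g \<in> measurable L L'"
  shows "indep_var N' (\<lambda>\<omega>. f (X \<omega>)) L' (\<lambda>\<omega>. g (Y \<omega>))"
proof -
  have *: "sigma_sets (space M) {(\<lambda>\<omega>. h (Z \<omega>)) -` A \<inter> space M |A. A \<in> sets B}
      \<subseteq> sets (vimage_algebra (space M) Z C)" if "Z \<in> measurable M C" "h \<in> measurable C B" for Z h B C
  proof -
    have "(\<lambda>\<omega>. h (Z \<omega>)) \<in> measurable (vimage_algebra (space M) Z C) B"
      using that by (intro measurable_compose[OF measurable_vimage_algebra1]) (auto dest: measurable_space)
    then have "{(\<lambda>\<omega>. h (Z \<omega>)) -` A \<inter> space M |A. A \<in> sets B} \<subseteq> sets (vimage_algebra (space M) Z C)"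
      by (auto dest: measurable_sets)
    from sets.sigma_sets_subset[OF this] show ?thesis by simp
  qed
  have "indep_set (sigma_sets (space M) {(\<lambda>\<omega>. f (X \<omega>)) -` A \<inter> space M |A. A \<in> sets N'})
      (sigma_sets (space M) {(\<lambda>\<omega>. g (Y \<omega>)) -` A \<inter> space M |A. A \<in> sets L'})"
    using assms(1) *[OF assms(2) f] *[OF assms(3) g] unfolding indep_set_def
    by (elim indep_sets_mono_sets) (auto split: bool.split)
  then show ?thesis
    using assms by (auto simp: indep_var_eq intro: measurable_compose)
qed

text \<open>The expectation of the product factorises, and the factor from \<open>X\<close> is
  centred.\<close>

lemma cross_cov_indep_vimage_algebra:
  assumes X: "square_integrable M X" and Y: "square_integrable M (\<lambda>\<omega>. f (Y \<omega>))"
    and "indep_set (sets (vimage_algebra (space M) X borel)) (sets (vimage_algebra (space M) Y L))"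
    and "Y \<in> measurable M L" and f[measurable]: "f \<in> borel_measurable L"
  shows "cross_cov M X (\<lambda>\<omega>. f (Y \<omega>)) = 0"
proof (rule matrix_eqI_inner)
  fix a b
  let ?f = "\<lambda>x. a \<bullet> (x - integral\<^sup>L M X)" and ?g = "\<lambda>y. b \<bullet> (f y - integral\<^sup>L M (\<lambda>\<omega>. f (Y \<omega>)))"
  have "indep_var borel (\<lambda>\<omega>. ?f (X \<omega>)) borel (\<lambda>\<omega>. ?g (Y \<omega>))"
    using X by (intro indep_var_vimage_algebra[OF assms(3) _ assms(4)]) (auto simp: square_integrable_def)
  then have "integral\<^sup>L M (\<lambda>\<omega>. ?f (X \<omega>) * ?g (Y \<omega>))
      = integral\<^sup>L M (\<lambda>\<omega>. ?f (X \<omega>)) * integral\<^sup>L M (\<lambda>\<omega>. ?g (Y \<omega>))"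
    using square_integrable_imp_integrable[OF X] square_integrable_imp_integrable[OF Y]
    by (intro indep_var_lebesgue_integral) auto
  also have "integral\<^sup>L M (\<lambda>\<omega>. ?f (X \<omega>)) = 0"
    using square_integrable_imp_integrable[OF X] by (simp add: inner_diff_right prob_space)
  finally show "a \<bullet> (cross_cov M X (\<lambda>\<omega>. f (Y \<omega>)) *v b) = a \<bullet> (0 *v b)"
    using X Y by (simp add: cross_cov_inner)
qed

lemma cross_cov_indep_vars:
  assumes indep: "indep_vars (\<lambda>_. borel) W I" and "i \<in> I" "j \<in> I" "i \<noteq> j"
    and W: "\<And>k. k \<in> I \<Longrightarrow> square_integrable M (W k)"
  shows "cross_cov M (W i) (W j) = 0"
proof (rule matrix_eqI_inner)
  fix a b
  \<comment> \<open>With \<open>a\<close> at index \<open>i\<close> and \<open>b\<close> at index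
    \<open>j\<close>, the product over \<open>{i, j}\<close> is the integrand of
    \<open>cross_cov_inner\<close>.\<close>
  define Y where "Y k x = (if k = i then a else b) \<bullet> (x - integral\<^sup>L M (W k))" for k x
  have "indep_vars (\<lambda>_. borel) (\<lambda>k \<omega>. Y k (W k \<omega>)) {i, j}"
    using assms(2,3) unfolding Y_def
    by (intro indep_vars_compose2[OF indep_vars_subset[OF indep]]) auto
  moreover have int: "integrable M (W k)" if "k \<in> {i, j}" for k
    using that assms by (intro square_integrable_imp_integrable) auto
  ultimately have "integral\<^sup>L M (\<lambda>\<omega>. \<Prod>k\<in>{i, j}. Y k (W k \<omega>)) = (\<Prod>k\<in>{i, j}. integral\<^sup>L M (\<lambda>\<omega>. Y k (W k \<omega>)))"
    by (intro indep_vars_lebesgue_integral) (auto simp: Y_def)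
  moreover have "integral\<^sup>L M (\<lambda>\<omega>. Y i (W i \<omega>)) = 0"
    using int[of i] by (simp add: Y_def inner_diff_right prob_space)
  ultimately have "integral\<^sup>L M (\<lambda>\<omega>. Y i (W i \<omega>) * Y j (W j \<omega>)) = 0"
    using \<open>i \<noteq> j\<close> by simp
  then show "a \<bullet> (cross_cov M (W i) (W j) *v b) = a \<bullet> (0 *v b)"
    using assms by (simp add: cross_cov_inner Y_def)
qed

end

subsection \<open>Gaussian vectors and the chi-square quantile\<close>

lemma integrable_normal_law_power2:
  assumes "0 \<le> s"
  shows "integrable (normal_law m s) (\<lambda>x. x\<^sup>2)"
proof (cases "s = 0")
  case True
  have "integrable (return borel m) (\<lambda>x :: real. x\<^sup>2)"
    by (simp add: integrable_iff_bounded nn_integral_return)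
  then show ?thesis using True by (simp add: normal_law_def)
next
  case False
  define \<sigma> where "\<sigma> = sqrt s"
  have "\<sigma> > 0" using assms False by (simp add: \<sigma>_def)
  then have "integrable lborel (\<lambda>x. normal_density m \<sigma> x * (x - m)^2)"
    and "integrable lborel (\<lambda>x. normal_density m \<sigma> x * x)"
    and "integrable lborel (\<lambda>x. normal_density m \<sigma> x)"
    by (auto intro: integrable_normal_moment integrable_normal_moment_nz_1)
  \<comment> \<open>Rests on \<open>x^2 = (x - m)^2 + 2 m x - m^2\<close>, which reduces the second
    moment to the central one, the mean and the total mass.\<close>
  then have "integrable lborel (\<lambda>x. normal_density m \<sigma> x * (x - m)^2
      + 2 * m * (normal_density m \<sigma> x * x) - m\<^sup>2 * normal_density m \<sigma> x)"
    by (intro Bochner_Integration.integrable_add Bochner_Integration.integrable_diff integrable_mult_right)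
  then have "integrable lborel (\<lambda>x. normal_density m \<sigma> x * x\<^sup>2)"
    by (simp add: power2_eq_square algebra_simps)
  then show ?thesis
    using False by (simp add: normal_law_def \<sigma>_def[symmetric] integrable_density)
qed

text \<open>Each coordinate is the functional given by a unit vector, hence normal;
  \<open>psd P\<close> makes its variance nonnegative.\<close>

lemma gaussian_vector_square_integrable:
  fixes X :: "'w \<Rightarrow> real^'d"
  assumes "gaussian_vector M X \<mu> P" "psd P"
  shows "square_integrable M X"
proof -
  have X[measurable]: "X \<in> borel_measurable M" using assms by (simp add: gaussian_vector_def)
  have "integrable M (\<lambda>\<omega>. (X \<omega> $ i)\<^sup>2)" for i
  proof -
    have "integrable (distr M borel (\<lambda>\<omega>. axis i 1 \<bullet> X \<omega>)) (\<lambda>x. x\<^sup>2)"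
      using assms by (auto simp: gaussian_vector_def psd_def intro: integrable_normal_law_power2)
    moreover have "(\<lambda>\<omega>. axis i 1 \<bullet> X \<omega>) \<in> borel_measurable M" by measurable
    ultimately show ?thesis by (subst (asm) integrable_distr_eq) (auto simp: inner_axis')
  qed
  then have "integrable M (\<lambda>\<omega>. \<Sum>i\<in>UNIV. (X \<omega> $ i)\<^sup>2)" by auto
  then show ?thesis
    by (simp add: square_integrable_def power2_norm_eq_inner inner_vec_def)
       (simp add: power2_eq_square)
qed

text \<open>This sign is what lets a smaller input covariance give a smaller cost. The chi-square
  cdf vanishes on the negative axis, so every point where it reaches \<open>1 - \<gamma> > 0\<close>
  is nonnegative.\<close>

lemma alpha_nonneg:
  assumes "0 < \<gamma>" "\<gamma> < 1"
  shows "0 \<le> alpha m \<gamma>"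
proof -
  define D where "D = chi_square_distribution m"
  interpret Z: prob_space "Pi\<^sub>M {..<m} (\<lambda>_. std_normal_distribution)"
    by (intro prob_space_PiM prob_space_normal_density) simp
  have meas[measurable]: "(\<lambda>z :: nat \<Rightarrow> real. \<Sum>i<m. (z i)\<^sup>2)
      \<in> borel_measurable (Pi\<^sub>M {..<m} (\<lambda>_. std_normal_distribution))"
    by measurable
  interpret D: real_distribution D
    unfolding D_def chi_square_distribution_def by (rule Z.real_distribution_distr) measurable
  have neg: "cdf D x = 0" if "x < 0" for x
  proof -
    have "\<not> (\<Sum>i<m. (z i)\<^sup>2) \<le> x" for z :: "nat \<Rightarrow> real"
      using that sum_nonneg[of "{..<m}" "\<lambda>i. (z i)\<^sup>2"] by (simp add: not_le)
    then have "(\<lambda>z :: nat \<Rightarrow> real. \<Sum>i<m. (z i)\<^sup>2) -` {..x} = {}" by auto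
    then show ?thesis
      unfolding cdf_def D_def chi_square_distribution_def by (subst measure_distr) auto
  qed
  have "\<forall>\<^sub>F x in at_top. 1 - \<gamma> < cdf D x"
    using D.cdf_lim_at_top_prob assms by (intro order_tendstoD) auto
  \<comment> \<open>A point of the set is needed because \<open>Inf\<close> of the empty set obeys
    no such bound.\<close>
  then obtain x where "1 - \<gamma> < cdf D x" by (auto simp: eventually_at_top_linorder)
  then have "{x. 1 - \<gamma> \<le> cdf D x} \<noteq> {}" by (auto intro: less_imp_le)
  then have "0 \<le> Inf {x. 1 - \<gamma> \<le> cdf D x}"
    using neg assms by (intro cInf_greatest) (auto simp: not_less[symmetric])
  then show ?thesis by (simp add: alpha_def inverse_cdf_def D_def)
qed

subsection \<open>Closed loops\<close>

text \<open>Second-order substitute for "determined before the noise at time \<open>k\<close> acts".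
  Unlike independence, being uncorrelated with the noise passes to sums by linearity.\<close>

definition noise_uncorrelated ::
    "('w, 'n::finite, 'm::finite, 'l::finite) lin_sys \<Rightarrow> nat \<Rightarrow> ('w \<Rightarrow> real^'d) \<Rightarrow> bool" where
  "noise_uncorrelated S k Y \<longleftrightarrow> square_integrable (prob_sp S) Y \<and>
     (\<forall>j. k \<le> j \<and> j < horizon S \<longrightarrow> cross_cov (prob_sp S) Y (noise S j) = 0)"

text \<open>The Markovian feedback written as history gains supported on the current state; this
  makes it a competitor in the optimisation problem.\<close>

definition markov_gains ::
    "('w, 'n::finite, 'm::finite, 'l::finite) lin_sys \<Rightarrow> (nat \<Rightarrow> real^'m)
      \<Rightarrow> (nat \<Rightarrow> nat \<Rightarrow> real^'n^'m) \<Rightarrow> nat \<Rightarrow> nat \<Rightarrow> real^'n^'m" where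
  "markov_gains S v K k i = (if i = k then markov_gain S v K k else 0)"

text \<open>Replaces the recursive equation as the unfolding rule, so that the input appears as
  \<open>control_C\<close>.\<close>

lemma state_C_Suc:
  "state_C S v K (Suc k) = (\<lambda>\<omega>. matA S k *v state_C S v K k \<omega>
     + matB S k *v control_C S v K k \<omega> + matG S k *v noise S k \<omega>)"
  by (simp add: next_state_def control_C_def)

declare state_C.simps(2) [simp del]

context
  fixes S :: "('w, 'n::finite, 'm::finite, 'l::finite) lin_sys"
  assumes lgs: "linear_gaussian_system S"
begin

interpretation prob_space "prob_sp S"
  using lgs by (simp add: linear_gaussian_system_def)

section \<open>Correlation of states and inputs with present and future noise\<close>

lemma square_integrable_noise: "k < horizon S \<Longrightarrow> square_integrable (prob_sp S) (noise S k)"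
  using lgs gaussian_vector_square_integrable[of "prob_sp S" "noise S k" 0 "mat 1"]
  by (simp add: linear_gaussian_system_def psd_def)

lemma noise_uncorrelated_add:
  "noise_uncorrelated S k X \<Longrightarrow> noise_uncorrelated S k Y \<Longrightarrow> noise_uncorrelated S k (\<lambda>\<omega>. X \<omega> + Y \<omega>)"
  by (auto simp: noise_uncorrelated_def cross_cov_add_left square_integrable_noise
      intro: square_integrable_add)

lemma noise_uncorrelated_const: "noise_uncorrelated S k (\<lambda>_. c)"
  by (simp add: noise_uncorrelated_def square_integrable_const cross_cov_const_left)

lemma noise_uncorrelated_matrix:
  fixes A :: "real^'a^'b"
  shows "noise_uncorrelated S k X \<Longrightarrow> noise_uncorrelated S k (\<lambda>\<omega>. A *v X \<omega>)"
  by (auto simp: noise_uncorrelated_def cross_cov_matrix_left square_integrable_noise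
      intro: square_integrable_matrix)

lemma noise_uncorrelated_sum:
  "(\<And>i. i \<in> I \<Longrightarrow> noise_uncorrelated S k (X i)) \<Longrightarrow> noise_uncorrelated S k (\<lambda>\<omega>. \<Sum>i\<in>I. X i \<omega>)"
  by (induction I rule: infinite_finite_induct)
     (auto intro: noise_uncorrelated_add noise_uncorrelated_const)

lemma noise_uncorrelated_mono:
  "noise_uncorrelated S k X \<Longrightarrow> k \<le> k' \<Longrightarrow> noise_uncorrelated S k' X"
  by (auto simp: noise_uncorrelated_def)

lemma noise_uncorrelated_init_state: "noise_uncorrelated S 0 (init_state S)"
proof -
  have init: "square_integrable (prob_sp S) (init_state S)"
    using lgs by (auto simp: linear_gaussian_system_def intro: gaussian_vector_square_integrable)
  have "cross_cov (prob_sp S) (init_state S) (noise S j) = 0" if j: "j < horizon S" for j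
  proof -
    let ?I = "{..<horizon S}"
    \<comment> \<open>For \<open>j\<close> below the horizon the restriction in the noise family is
      invisible, so evaluation at \<open>j\<close> recovers the noise itself.\<close>
    have *: "(\<lambda>\<omega>. (\<lambda>k\<in>?I. noise S k \<omega>) j) = noise S j" using j by auto
    have "cross_cov (prob_sp S) (init_state S) (\<lambda>\<omega>. (\<lambda>k\<in>?I. noise S k \<omega>) j) = 0"
    proof (rule cross_cov_indep_vimage_algebra[where f = "\<lambda>f. f j"
          and Y = "\<lambda>\<omega>. \<lambda>k\<in>?I. noise S k \<omega>"])
      show "square_integrable (prob_sp S) (\<lambda>\<omega>. (\<lambda>k\<in>?I. noise S k \<omega>) j)"
        unfolding * by (rule square_integrable_noise[OF j])
      show "(\<lambda>\<omega>. \<lambda>k\<in>?I. noise S k \<omega>) \<in> measurable (prob_sp S) (Pi\<^sub>M ?I (\<lambda>_. borel))"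
        using square_integrable_noise by (intro measurable_restrict) (auto simp: square_integrable_def)
      show "(\<lambda>f. f j) \<in> borel_measurable (Pi\<^sub>M ?I (\<lambda>_. borel))"
        using j by (intro measurable_component_singleton) simp
    qed (use lgs init in \<open>auto simp: linear_gaussian_system_def\<close>)
    then show ?thesis unfolding * .
  qed
  with init show ?thesis by (simp add: noise_uncorrelated_def)
qed

text \<open>The index is \<open>Suc k\<close> because the noise is correlated with itself at time
  \<open>k\<close>; independence covers the later times.\<close>

lemma noise_uncorrelated_noise:
  assumes "k < horizon S"
  shows "noise_uncorrelated S (Suc k) (noise S k)"
proof -
  have "cross_cov (prob_sp S) (noise S k) (noise S j) = 0" if "Suc k \<le> j" "j < horizon S" for j
    using that assms lgs square_integrable_noise
    by (intro cross_cov_indep_vars[of _ "{..<horizon S}"]) (auto simp: linear_gaussian_system_def)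
  with assms show ?thesis by (simp add: noise_uncorrelated_def square_integrable_noise)
qed

lemma noise_uncorrelated_affine_input:
  assumes "\<And>i. i \<le> k \<Longrightarrow> noise_uncorrelated S k (x i)"
  shows "noise_uncorrelated S k (affine_input (prob_sp S) v K k x)"
proof -
  have "noise_uncorrelated S k (\<lambda>\<omega>. v k + (\<Sum>i\<le>k. K k i *v (x i \<omega> + (- integral\<^sup>L (prob_sp S) (x i)))))"
    using assms
    by (intro noise_uncorrelated_add noise_uncorrelated_const noise_uncorrelated_sum
        noise_uncorrelated_matrix) auto
  then show ?thesis by (simp add: affine_input_def)
qed

text \<open>Strong induction, because the input at time \<open>j\<close> depends on all states up to
  \<open>j\<close>.\<close>

lemma noise_uncorrelated_state_C: "k \<le> horizon S \<Longrightarrow> noise_uncorrelated S k (state_C S v K k)"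
proof (induction k rule: less_induct)
  case (less k)
  show ?case
  proof (cases k)
    case 0
    then show ?thesis by (simp add: noise_uncorrelated_init_state)
  next
    case (Suc j)
    have states: "noise_uncorrelated S j (state_C S v K i)" if "i \<le> j" for i
      using less Suc that by (auto intro: noise_uncorrelated_mono[of i])
    then have "noise_uncorrelated S j (control_C S v K j)"
      unfolding control_C_def by (rule noise_uncorrelated_affine_input)
    with states[of j] show ?thesis
      unfolding Suc state_C_Suc using less.prems Suc
      by (intro noise_uncorrelated_add noise_uncorrelated_matrix noise_uncorrelated_noise)
         (auto intro: noise_uncorrelated_mono[of j])
  qed
qed

lemma noise_uncorrelated_control_C: "k \<le> horizon S \<Longrightarrow> noise_uncorrelated S k (control_C S v K k)"
  unfolding control_C_def
  by (rule noise_uncorrelated_affine_input)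
     (auto intro: noise_uncorrelated_mono[OF noise_uncorrelated_state_C])

lemma square_integrable_state_C: "k \<le> horizon S \<Longrightarrow> square_integrable (prob_sp S) (state_C S v K k)"
  and square_integrable_control_C: "k \<le> horizon S \<Longrightarrow> square_integrable (prob_sp S) (control_C S v K k)"
  using noise_uncorrelated_state_C noise_uncorrelated_control_C by (auto simp: noise_uncorrelated_def)

section \<open>Means of states and inputs\<close>

lemma expectation_control_C:
  assumes "k \<le> horizon S"
  shows "integral\<^sup>L (prob_sp S) (control_C S v K k) = v k"
proof -
  let ?x = "state_C S v K"
  let ?z = "\<lambda>i \<omega>. ?x i \<omega> - integral\<^sup>L (prob_sp S) (?x i)"
  have z: "square_integrable (prob_sp S) (?z i)" if "i \<le> k" for i
    using that assms by (intro square_integrable_centered square_integrable_state_C) simp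
  have "integral\<^sup>L (prob_sp S) (?z i) = 0" if "i \<le> k" for i
    using that assms square_integrable_imp_integrable[OF square_integrable_state_C[of i v K]]
    by (simp add: prob_space)
  then have Kz: "integral\<^sup>L (prob_sp S) (\<lambda>\<omega>. K k i *v ?z i \<omega>) = 0" if "i \<le> k" for i
    using that expectation_matrix[OF z] by simp
  have int: "integrable (prob_sp S) (\<lambda>\<omega>. K k i *v ?z i \<omega>)" if "i \<le> k" for i
    using that by (intro square_integrable_imp_integrable square_integrable_matrix z)
  have "integral\<^sup>L (prob_sp S) (control_C S v K k)
      = v k + (\<Sum>i\<le>k. integral\<^sup>L (prob_sp S) (\<lambda>\<omega>. K k i *v ?z i \<omega>))"
    unfolding control_C_def affine_input_def
    by (subst Bochner_Integration.integral_add, simp, rule Bochner_Integration.integrable_sum)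
       (simp_all add: int prob_space Bochner_Integration.integral_sum)
  then show ?thesis by (simp add: Kz)
qed

lemma expectation_state_C_Suc:
  assumes "k < horizon S"
  shows "integral\<^sup>L (prob_sp S) (state_C S v K (Suc k)) = matA S k *v integral\<^sup>L (prob_sp S) (state_C S v K k)
    + matB S k *v v k + matG S k *v integral\<^sup>L (prob_sp S) (noise S k)"
proof -
  have "square_integrable (prob_sp S) (state_C S v K k)"
    and "square_integrable (prob_sp S) (control_C S v K k)"
    and "square_integrable (prob_sp S) (noise S k)"
    using assms by (simp_all add: square_integrable_state_C square_integrable_control_C square_integrable_noise)
  then show ?thesis
    using assms unfolding state_C_Suc
    by (simp add: expectation_matrix expectation_control_C square_integrable_imp_integrable square_integrable_matrix)
qed

text \<open>The feedback acts on centred states, so the recursion for the mean contains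
  \<open>v\<close> but no gain.\<close>

lemma expectation_state_C_gains:
  "k \<le> horizon S \<Longrightarrow>
     integral\<^sup>L (prob_sp S) (state_C S v K k) = integral\<^sup>L (prob_sp S) (state_C S v K' k)"
  by (induction k) (simp_all add: expectation_state_C_Suc)

section \<open>The Markovian policy as a state-history-affine policy\<close>

lemma control_C_markov_gains:
  "control_C S v (markov_gains S v K) k = (\<lambda>\<omega>. v k + markov_gain S v K k *v
     (state_C S v (markov_gains S v K) k \<omega> - integral\<^sup>L (prob_sp S) (state_C S v (markov_gains S v K) k)))"
proof -
  have "(\<Sum>i\<le>k. (if i = k then H else 0) *v y i) = H *v y k" for H :: "real^'n^'m" and y
    by (simp add: if_distrib[of "\<lambda>A. A *v _"] cong: if_cong)
  then show ?thesis by (simp add: control_C_def affine_input_def markov_gains_def)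
qed

text \<open>\<open>markov_policy\<close> centres the state at its mean in the original loop, the
  affine input at the mean in its own loop; the two means agree.\<close>

lemma markov_policy_markov_gains:
  assumes "k \<le> horizon S"
  shows "markov_policy S v K k (state_C S v (markov_gains S v K) k \<omega>)
    = control_C S v (markov_gains S v K) k \<omega>"
  unfolding markov_policy_def control_C_markov_gains
  using expectation_state_C_gains[OF assms, of v K "markov_gains S v K"] by simp

lemma state_M_markov_policy:
  "k \<le> horizon S \<Longrightarrow> state_M S (markov_policy S v K) k = state_C S v (markov_gains S v K) k"
  by (induction k) (simp_all add: next_state_def state_C_Suc markov_policy_markov_gains)

lemma control_M_markov_policy:
  "k \<le> horizon S \<Longrightarrow> control_M S (markov_policy S v K) k = control_C S v (markov_gains S v K) k"
  by (simp add: control_M_def state_M_markov_policy markov_policy_markov_gains)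

section \<open>Covariance recursions\<close>

text \<open>Stated for any decomposition of the input into feedback \<open>H\<close> and a part
  \<open>e\<close> uncorrelated with the state, so that it serves both loops: \<open>e\<close> will
  be the regression residual in one and a constant in the other.\<close>

lemma cov_state_C_Suc:
  assumes k: "k < horizon S"
    and u: "control_C S v K k = (\<lambda>\<omega>. H *v state_C S v K k \<omega> + e \<omega>)"
    and e: "square_integrable (prob_sp S) e"
    and xe: "cross_cov (prob_sp S) (state_C S v K k) e = 0"
  shows "cov (prob_sp S) (state_C S v K (Suc k)) =
      (matA S k + matB S k ** H) ** cov (prob_sp S) (state_C S v K k) ** transpose (matA S k + matB S k ** H)
      + matB S k ** cov (prob_sp S) e ** transpose (matB S k)
      + matG S k ** cov (prob_sp S) (noise S k) ** transpose (matG S k)"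
proof -
  let ?M = "prob_sp S" and ?x = "state_C S v K k" and ?u = "control_C S v K k" and ?w = "noise S k"
  let ?F = "matA S k + matB S k ** H"
  have x: "square_integrable ?M ?x" using k by (simp add: square_integrable_state_C)
  have w: "square_integrable ?M ?w" using k by (rule square_integrable_noise)
  have "noise_uncorrelated S k (\<lambda>\<omega>. matA S k *v ?x \<omega> + matB S k *v ?u \<omega>)"
    using k by (intro noise_uncorrelated_add noise_uncorrelated_matrix
        noise_uncorrelated_state_C noise_uncorrelated_control_C) auto
  then have p: "square_integrable ?M (\<lambda>\<omega>. matA S k *v ?x \<omega> + matB S k *v ?u \<omega>)"
    and pw: "cross_cov ?M (\<lambda>\<omega>. matA S k *v ?x \<omega> + matB S k *v ?u \<omega>) ?w = 0"
    using k by (auto simp: noise_uncorrelated_def)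
  have "cov ?M (state_C S v K (Suc k)) = cov ?M (\<lambda>\<omega>. matA S k *v ?x \<omega> + matB S k *v ?u \<omega>)
      + matG S k ** cov ?M ?w ** transpose (matG S k)"
    unfolding state_C_Suc
    by (subst cov_add_uncorrelated)
       (simp_all add: p w pw square_integrable_matrix cross_cov_matrix_right cov_matrix)
  also have "(\<lambda>\<omega>. matA S k *v ?x \<omega> + matB S k *v ?u \<omega>) = (\<lambda>\<omega>. ?F *v ?x \<omega> + matB S k *v e \<omega>)"
    by (simp add: u matrix_vector_mult_add_rdistrib matrix_vector_right_distrib matrix_vector_mul_assoc add.assoc)
  also have "cov ?M \<dots> = ?F ** cov ?M ?x ** transpose ?F + matB S k ** cov ?M e ** transpose (matB S k)"
    by (subst cov_add_uncorrelated)
       (simp_all add: x e xe square_integrable_matrix cross_cov_matrix_right cross_cov_matrix_left cov_matrix)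
  finally show ?thesis .
qed

lemma cov_control_C:
  assumes k: "k \<le> horizon S"
    and u: "control_C S v K k = (\<lambda>\<omega>. H *v state_C S v K k \<omega> + e \<omega>)"
    and e: "square_integrable (prob_sp S) e"
    and xe: "cross_cov (prob_sp S) (state_C S v K k) e = 0"
  shows "cov (prob_sp S) (control_C S v K k) =
      H ** cov (prob_sp S) (state_C S v K k) ** transpose H + cov (prob_sp S) e"
  unfolding u
  by (subst cov_add_uncorrelated)
     (simp_all add: square_integrable_state_C[OF k] e xe square_integrable_matrix cross_cov_matrix_left cov_matrix)

section \<open>Comparison of the two closed loops\<close>

lemma markov_gain_regression:
  assumes "k \<le> horizon S"
  obtains e where "control_C S v K k = (\<lambda>\<omega>. markov_gain S v K k *v state_C S v K k \<omega> + e \<omega>)"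
    "square_integrable (prob_sp S) e" "cross_cov (prob_sp S) (state_C S v K k) e = 0"
  by (rule linear_regression[OF square_integrable_control_C[OF assms] square_integrable_state_C[OF assms]])
     (rule that, unfold markov_gain_def)

lemma markov_gains_regression:
  obtains c where "control_C S v (markov_gains S v K) k
    = (\<lambda>\<omega>. markov_gain S v K k *v state_C S v (markov_gains S v K) k \<omega> + c)"
proof
  let ?m = "integral\<^sup>L (prob_sp S) (state_C S v (markov_gains S v K) k)"
  show "control_C S v (markov_gains S v K) k = (\<lambda>\<omega>. markov_gain S v K k *v
      state_C S v (markov_gains S v K) k \<omega> + (v k - markov_gain S v K k *v ?m))"
    by (simp add: control_C_markov_gains matrix_vector_mult_diff_distrib fun_eq_iff)
qed

text \<open>Both closed loops are driven by the same feedback \<open>H\<close>; the history-dependent one has the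
  regression residual \<open>e\<close> as an additional disturbance.\<close>

lemma cov_state_C_markov_gains_le:
  "k \<le> horizon S \<Longrightarrow>
    cov (prob_sp S) (state_C S v (markov_gains S v K) k) \<preceq>\<^sub>L cov (prob_sp S) (state_C S v K k)"
proof (induction k)
  case 0
  show ?case by (simp add: loewner_le_refl)
next
  case (Suc k)
  then have k: "k < horizon S" by simp
  obtain e where e: "control_C S v K k = (\<lambda>\<omega>. markov_gain S v K k *v state_C S v K k \<omega> + e \<omega>)"
    "square_integrable (prob_sp S) e" "cross_cov (prob_sp S) (state_C S v K k) e = 0"
    by (rule markov_gain_regression[OF less_imp_le[OF k]])
  obtain c where c: "control_C S v (markov_gains S v K) k
      = (\<lambda>\<omega>. markov_gain S v K k *v state_C S v (markov_gains S v K) k \<omega> + c)"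
    by (rule markov_gains_regression)
  show ?case
    unfolding cov_state_C_Suc[OF k e]
      cov_state_C_Suc[OF k c square_integrable_const cross_cov_const_right]
    by (intro loewner_le_add loewner_le_congruence loewner_le_refl Suc.IH less_imp_le[OF k]
        cov_const_loewner_le[OF e(2)])
qed

text \<open>Both inputs use the same \<open>H\<close>, so the order of the state covariances carries
  over; the residual only adds to the original input.\<close>

lemma cov_control_C_markov_gains_le:
  assumes k: "k \<le> horizon S"
  shows "cov (prob_sp S) (control_C S v (markov_gains S v K) k) \<preceq>\<^sub>L cov (prob_sp S) (control_C S v K k)"
proof -
  obtain e where e: "control_C S v K k = (\<lambda>\<omega>. markov_gain S v K k *v state_C S v K k \<omega> + e \<omega>)"
    "square_integrable (prob_sp S) e" "cross_cov (prob_sp S) (state_C S v K k) e = 0"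
    by (rule markov_gain_regression[OF k])
  obtain c where c: "control_C S v (markov_gains S v K) k
      = (\<lambda>\<omega>. markov_gain S v K k *v state_C S v (markov_gains S v K) k \<omega> + c)"
    by (rule markov_gains_regression)
  show ?thesis
    unfolding cov_control_C[OF k e]
      cov_control_C[OF k c square_integrable_const cross_cov_const_right]
    by (intro loewner_le_add loewner_le_congruence cov_state_C_markov_gains_le[OF k]
        cov_const_loewner_le[OF e(2)])
qed

section \<open>Cost and feasibility\<close>

lemma J_VaR_markov_gains_le:
  assumes "0 < \<gamma>" "\<gamma> < 1"
  shows "J_VaR S \<gamma> v (control_C S v (markov_gains S v K)) \<le> J_VaR S \<gamma> v (control_C S v K)"
proof -
  let ?P = "\<lambda>K k. cov (prob_sp S) (control_C S v K k)"
  have "sqrt (lambda_max (?P (markov_gains S v K) k)) \<le> sqrt (lambda_max (?P K k))"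
    if "k < horizon S" for k
    using that lambda_max_mono[OF transpose_cov transpose_cov cov_control_C_markov_gains_le, of k]
    by simp
  then show ?thesis
    unfolding J_VaR_def using alpha_nonneg[OF assms]
    by (auto intro!: sum_mono mult_left_mono)
qed

text \<open>The means agree in both loops, so only the covariance argument of each constraint
  changes, and it decreases in the Loewner order.\<close>

lemma feasible_C_markov_gains:
  assumes "covariance_monotonic g\<^sub>x" "covariance_monotonic g\<^sub>u" "feasible_C S g\<^sub>x g\<^sub>u v K"
  shows "feasible_C S g\<^sub>x g\<^sub>u v (markov_gains S v K)"
proof -
  let ?M = "prob_sp S" and ?K = "markov_gains S v K"
  have "g\<^sub>x (integral\<^sup>L ?M (state_C S v ?K k)) (cov ?M (state_C S v ?K k)) \<le> 0"
    if k: "k \<in> {1..horizon S}" for k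
  proof -
    have mean: "integral\<^sup>L ?M (state_C S v ?K k) = integral\<^sup>L ?M (state_C S v K k)"
      using k by (intro expectation_state_C_gains) simp
    have "g\<^sub>x (integral\<^sup>L ?M (state_C S v K k)) (cov ?M (state_C S v ?K k))
        \<le> g\<^sub>x (integral\<^sup>L ?M (state_C S v K k)) (cov ?M (state_C S v K k))"
      using assms(1) k
      by (auto simp: covariance_monotonic_def psd_cov square_integrable_state_C cov_state_C_markov_gains_le)
    also have "\<dots> \<le> 0"
      using assms(3) k by (auto simp: feasible_C_def satisfies_constraints_def)
    finally show ?thesis by (simp only: mean)
  qed
  moreover have "g\<^sub>u (integral\<^sup>L ?M (control_C S v ?K k)) (cov ?M (control_C S v ?K k)) \<le> 0"
    if k: "k < horizon S" for k
  proof -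
    have "g\<^sub>u (v k) (cov ?M (control_C S v ?K k)) \<le> g\<^sub>u (v k) (cov ?M (control_C S v K k))"
      using assms(2) k
      by (auto simp: covariance_monotonic_def psd_cov square_integrable_control_C cov_control_C_markov_gains_le)
    also have "\<dots> \<le> 0"
      using assms(3) k by (auto simp: feasible_C_def satisfies_constraints_def expectation_control_C)
    finally show ?thesis using k by (simp add: expectation_control_C)
  qed
  ultimately show ?thesis by (simp add: feasible_C_def satisfies_constraints_def)
qed

end

theorem proposition1:
  fixes S :: "('w, 'n::finite, 'm::finite, 'l::finite) lin_sys"
    and \<gamma> :: real
    and g\<^sub>x :: "real^'n \<Rightarrow> real^'n^'n \<Rightarrow> real"
    and g\<^sub>u :: "real^'m \<Rightarrow> real^'m^'m \<Rightarrow> real"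
    and v :: "nat \<Rightarrow> real^'m"
    and K :: "nat \<Rightarrow> nat \<Rightarrow> real^'n^'m"
  assumes "linear_gaussian_system S"
    and "0 < \<gamma>" and "\<gamma> < 1"
    and "covariance_monotonic g\<^sub>x" and "covariance_monotonic g\<^sub>u"
    and "optimal_C S \<gamma> g\<^sub>x g\<^sub>u v K"
  shows "let M = prob_sp S; N = horizon S;
             xC = state_C S v K; uC = control_C S v K;
             \<pi> = markov_policy S v K;
             xM = state_M S \<pi>; uM = control_M S \<pi>
         in satisfies_constraints S g\<^sub>x g\<^sub>u xM uM \<and>
            J_VaR S \<gamma> v uM = J_VaR S \<gamma> v uC \<and>
            (\<forall>k\<le>N. integral\<^sup>L M (xM k) = integral\<^sup>L M (xC k)) \<and>
            (\<forall>k<N. integral\<^sup>L M (uM k) = integral\<^sup>L M (uC k)) \<and>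
            (\<forall>k\<le>N. cov M (xM k) \<preceq>\<^sub>L cov M (xC k)) \<and>
            (\<forall>k<N. cov M (uM k) \<preceq>\<^sub>L cov M (uC k))"
proof -
  let ?K = "markov_gains S v K" and ?\<pi> = "markov_policy S v K"
  \<comment> \<open>Everything about the Markovian loop is rewritten as a statement about the affine
    loop with gains \<open>?K\<close>.\<close>
  note x = state_M_markov_policy[OF assms(1), of _ v K]
  note u = control_M_markov_policy[OF assms(1), of _ v K]
  have feas: "feasible_C S g\<^sub>x g\<^sub>u v ?K"
    using assms by (intro feasible_C_markov_gains) (auto simp: optimal_C_def)
  \<comment> \<open>Optimality of \<open>(v, K)\<close> against the feasible competitor
    \<open>(v, ?K)\<close> gives one inequality; the covariance comparison gives the other.\<close>
  then have "J_VaR S \<gamma> v (control_C S v K) \<le> J_VaR S \<gamma> v (control_C S v ?K)"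
    using assms(6) by (simp add: optimal_C_def)
  then have "J_VaR S \<gamma> v (control_C S v ?K) = J_VaR S \<gamma> v (control_C S v K)"
    using J_VaR_markov_gains_le[OF assms(1-3), of v K] by simp
  moreover have "J_VaR S \<gamma> v (control_M S ?\<pi>) = J_VaR S \<gamma> v (control_C S v ?K)"
    by (simp add: J_VaR_def u)
  moreover have "satisfies_constraints S g\<^sub>x g\<^sub>u (state_M S ?\<pi>) (control_M S ?\<pi>)"
    using feas by (simp add: feasible_C_def satisfies_constraints_def x u)
  ultimately show ?thesis
    using assms(1)
    by (simp add: Let_def x u expectation_control_C cov_state_C_markov_gains_le
        cov_control_C_markov_gains_le expectation_state_C_gains[OF assms(1), of _ v ?K K])
qed

end
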